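(* Let $k \geq 3$ be an integer and let $t \in \mathbb{Z}_{2^k}$. If $t \neq 0$, write $t = 2^{\alpha}\beta$ where $2 \nmid \beta$ and $0 \le \alpha < k$. If $t = 0$, then $$ N_{3}(0, 2^k) = \begin{cases} 2^{3k/2} & \text{if } k \text{ is even}, \\ 2^{(3k+1)/2} & \text{if } k \text{ is odd}. \end{cases} $$ If $t \neq 0$, then $$ N_{3}(t, 2^k) = \begin{cases} 3 \times 2^{2k - \alpha/2 - 1} & \text{if } k - \alpha > 2,\ \alpha \text{ is even and } \beta \equiv 1 \pmod 4, \\ 2^{2k - \alpha/2} & \text{if } k - \alpha > 2,\ \alpha \text{ is even and } \beta \equiv 3 \pmod 8, \\ 0 & \text{if } k - \alpha > 2,\ \alpha \text{ is even and } \beta \equiv 7 \pmod 8, \\ 3 \times 2^{2k - (\alpha + 1)/2} & \text{if } k - \alpha > 2 \text{ and } \alpha \text{ is odd}, \\ 3 \times 2^{3k/2} & \text{if } k - \alpha = 2,\ \alpha \text{ is even and } \beta \equiv 1 \pmod 4, \\ 2^{3k/2} & \text{if } k - \alpha = 2,\ \alpha \text{ is even and } \beta \equiv 3 \pmod 4, \\ 3 \times 2^{(3k + 1)/2} & \text{if } k - \alpha = 2 \text{ and } \alpha \text{ is odd}, \\ 2^{(3k + 1)/2} & \text{if } k - \alpha = 1 \text{ and } \alpha \text{ is even}, \\ 3 \times 2^{3k/2} & \text{if } k - \alpha = 1 \text{ and } \alpha \text{ is odd.} \end{cases} $$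
   Context: $\mathbb{Z}_n$ denotes the ring of integers modulo $n$. For $t \in \mathbb{Z}_n$, $N_3(t,n)$ is the number of ordered triples $(x_1,x_2,x_3) \in \mathbb{Z}_n^3$ with $x_1^2+x_2^2+x_3^2 \equiv t \pmod n$ (zero entries are allowed). In the factorization $t = 2^{\alpha}\beta$ the element $t$ is represented by a nonzero integer in $\{1,\dots,2^k-1\}$. *)

theory Defs
  imports "HOL-Number_Theory.Number_Theory"
begin

text \<open>The elements of \<open>\<int>\<^sub>n\<close> are represented by the integers \<open>0, \<dots>, n - 1\<close>, as in the
  carrier of the library's \<^const>\<open>residue_ring\<close>.\<close>

definition N3 :: "int \<Rightarrow> nat \<Rightarrow> nat" where
  "N3 t n = card {(x1, x2, x3).
     x1 \<in> carrier (residue_ring (int n)) \<and>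
     x2 \<in> carrier (residue_ring (int n)) \<and>
     x3 \<in> carrier (residue_ring (int n)) \<and>
     [x1\<^sup>2 + x2\<^sup>2 + x3\<^sup>2 = t] (mod int n)}"

end

theory Submission
  imports Defs
begin

text \<open>
  Two reductions determine every count. A sum of three squares is divisible by \<open>4\<close> only if all
  three numbers are even, since a square is \<open>0\<close> or \<open>1\<close> modulo \<open>4\<close>. Halving the three numbers
  therefore gives \<open>N3 (4 * t) (4 * n) = 8 * N3 t n\<close> (lemma \<open>N3_four_mult\<close>); the factor \<open>8\<close> appears
  because the halves are determined modulo \<open>2 * n\<close>, not modulo \<open>n\<close>. If \<open>t\<close> is not divisible by
  \<open>4\<close>, every solution has an odd entry \<open>x\<close>, and \<open>(x + 4 * q)\<^sup>2 \<equiv> x\<^sup>2 + 8 * q\<close> modulo \<open>16 * q\<close>.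
  Moving one odd entry in this way exchanges the solutions for \<open>t\<close> with those for \<open>t + 8 * q\<close>, so
  the \<open>8 * N3 t (8 * q)\<close> lifts to modulus \<open>16 * q\<close> of the solutions modulo \<open>8 * q\<close> split evenly
  between these two targets, and \<open>N3 t (16 * q) = 4 * N3 t (8 * q)\<close> (lemma \<open>N3_double\<close>).

  Stripping the factors of \<open>4\<close> from \<open>t\<close>, together with the same power of \<open>4\<close> from the modulus,
  leaves either a modulus \<open>1\<close>, \<open>2\<close> or \<open>4\<close>, or a target prime to \<open>4\<close> or twice odd, modulo a power
  of two that is at least \<open>8\<close>; the second reduction brings that power down to \<open>8\<close>. The moduli up to
  \<open>8\<close> are checked by enumeration.
\<close>

section \<open>Lifting solutions to a multiple of the modulus\<close>

lemma N3_eq_card_mod: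
  "N3 t n = card {(x, y, z). x \<in> {0..<int n} \<and> y \<in> {0..<int n} \<and> z \<in> {0..<int n} \<and>
     (x\<^sup>2 + y\<^sup>2 + z\<^sup>2) mod int n = t mod int n}"
proof -
  have "carrier (residue_ring (int n)) = {0..<int n}"
    by (auto simp: residue_ring_def)
  then show ?thesis
    unfolding N3_def cong_def by simp
qed

lemma N3_cong: "[s = t] (mod int n) \<Longrightarrow> N3 s n = N3 t n"
  by (simp add: N3_eq_card_mod cong_def)

lemma finite_triples:
  "finite {(x, y, z). x \<in> {0..<a::int} \<and> y \<in> {0..<a} \<and> z \<in> {0..<a} \<and> P x y z}"
  by (rule finite_subset[of _ "{0..<a} \<times> {0..<a} \<times> {0..<a}"]) auto

text \<open>Division with remainder identifies a residue modulo \<open>d * m\<close> with a residue modulo \<open>m\<close> and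
  one of \<open>d\<close> quotients. The predicate sees only the remainders.\<close>

lemma card_periodic_triples:
  fixes P :: "int \<Rightarrow> int \<Rightarrow> int \<Rightarrow> bool" and m d :: nat
  assumes "m > 0"
    and periodic: "\<And>x y z. P (x mod int m) (y mod int m) (z mod int m) = P x y z"
  shows "card {(x, y, z). x \<in> {0..<int (d * m)} \<and> y \<in> {0..<int (d * m)} \<and>
             z \<in> {0..<int (d * m)} \<and> P x y z}
       = d ^ 3 * card {(x, y, z). x \<in> {0..<int m} \<and> y \<in> {0..<int m} \<and> z \<in> {0..<int m} \<and> P x y z}"
    (is "card ?A = d ^ 3 * card ?B")
proof -
  let ?D = "{0..<int d}"
  let ?f = "\<lambda>(x, y, z). ((x mod int m, y mod int m, z mod int m),
                         (x div int m, y div int m, z div int m))"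
  let ?g = "\<lambda>((a, b, c), (i, j, l)). (a + int m * i, b + int m * j, c + int m * l)"
  have quot: "x div int m \<in> ?D" if "x \<in> {0..<int (d * m)}" for x
  proof -
    have "int m * (x div int m) \<le> x"
      using \<open>m > 0\<close> pos_mod_sign[of "int m" x] mult_div_mod_eq[of "int m" x] by linarith
    also have "x < int m * int d"
      using that by (simp add: mult.commute)
    finally show ?thesis
      using that \<open>m > 0\<close> by (simp add: pos_imp_zdiv_nonneg_iff)
  qed
  have recomb: "a + int m * i \<in> {0..<int (d * m)}" if "a \<in> {0..<int m}" "i \<in> ?D" for a i
  proof -
    have "int m * (i + 1) \<le> int m * int d"
      using that by (intro mult_left_mono) auto
    then show ?thesis
      using that by (auto simp: algebra_simps)
  qed
  have periodic': "P (a + int m * i) (b + int m * j) (c + int m * l) = P a b c" for a b c i j l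
    using periodic[of "a + int m * i" "b + int m * j" "c + int m * l"] periodic[of a b c] by simp
  have "bij_betw ?f ?A (?B \<times> (?D \<times> ?D \<times> ?D))"
  proof (rule bij_betw_byWitness[where f' = ?g])
    show "\<forall>v\<in>?A. ?g (?f v) = v"
      by auto
    show "\<forall>v\<in>?B \<times> (?D \<times> ?D \<times> ?D). ?f (?g v) = v"
      using \<open>m > 0\<close> by auto
    show "?f ` ?A \<subseteq> ?B \<times> (?D \<times> ?D \<times> ?D)"
      using quot \<open>m > 0\<close> by (auto simp: periodic simp del: atLeastLessThan_iff) auto
    show "?g ` (?B \<times> (?D \<times> ?D \<times> ?D)) \<subseteq> ?A"
      using recomb by (auto simp: periodic' simp del: atLeastLessThan_iff)
  qed
  then have "card ?A = card (?B \<times> (?D \<times> ?D \<times> ?D))"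
    by (rule bij_betw_same_card)
  also have "\<dots> = d ^ 3 * card ?B"
    by (simp add: card_cartesian_product power3_eq_cube)
  finally show ?thesis .
qed

text \<open>Entries run modulo \<open>2 * n\<close> while the congruence is modulo \<open>n\<close>. Halving even triples and
  doubling the modulus both lead to this mixed count.\<close>

lemma card_lifted_solutions:
  assumes "n > 0"
  shows "card {(x, y, z). x \<in> {0..<int (2 * n)} \<and> y \<in> {0..<int (2 * n)} \<and> z \<in> {0..<int (2 * n)} \<and>
             (x\<^sup>2 + y\<^sup>2 + z\<^sup>2) mod int n = t mod int n}
       = 8 * N3 t n"
proof -
  have "((x mod int n)\<^sup>2 + (y mod int n)\<^sup>2 + (z mod int n)\<^sup>2) mod int n = (x\<^sup>2 + y\<^sup>2 + z\<^sup>2) mod int n"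
    for x y z
    by (intro cong_add cong_pow cong_mod_left cong_refl | simp flip: cong_def)+
  then show ?thesis
    using card_periodic_triples[OF assms,
        where d = 2 and P = "\<lambda>x y z. (x\<^sup>2 + y\<^sup>2 + z\<^sup>2) mod int n = t mod int n"]
    by (simp add: N3_eq_card_mod)
qed

text \<open>A residue modulo \<open>n\<close> splits into exactly two residues modulo \<open>2 * n\<close>.\<close>

lemma N3_lift_sum:
  assumes "n > 0"
  shows "N3 t (2 * n) + N3 (t + int n) (2 * n) = 8 * N3 t n"
proof -
  let ?S = "\<lambda>Q. {(x, y, z). x \<in> {0..<int (2 * n)} \<and> y \<in> {0..<int (2 * n)} \<and>
                  z \<in> {0..<int (2 * n)} \<and> Q ((x::int)\<^sup>2 + (y::int)\<^sup>2 + (z::int)\<^sup>2)}"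
  let ?P = "\<lambda>s. s mod int (2 * n) = t mod int (2 * n)"
  let ?Q = "\<lambda>s. s mod int (2 * n) = (t + int n) mod int (2 * n)"
  have split: "s mod int n = t mod int n \<longleftrightarrow> ?P s \<or> ?Q s" for s
  proof -
    have "s mod int n = t mod int n \<longleftrightarrow> int n dvd s - t"
      by (simp add: mod_eq_dvd_iff)
    also have "\<dots> \<longleftrightarrow> int (2 * n) dvd s - t \<or> int (2 * n) dvd s - (t + int n)"
    proof
      assume "int n dvd s - t"
      then obtain c where c: "s - t = int n * c" by blast
      show "int (2 * n) dvd s - t \<or> int (2 * n) dvd s - (t + int n)"
      proof (cases "even c")
        case True
        then show ?thesis using c by (auto elim!: evenE)
      next
        case False
        then obtain e where "c = 2 * e + 1" by (elim oddE)
        then have "s - (t + int n) = int (2 * n) * e"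
          using c by (simp add: algebra_simps)
        then show ?thesis by (metis dvd_triv_left)
      qed
    next
      assume disj: "int (2 * n) dvd s - t \<or> int (2 * n) dvd s - (t + int n)"
      have "int n dvd int (2 * n)"
        by simp
      with disj consider "int n dvd s - t" | "int n dvd s - (t + int n)"
        using dvd_trans by blast
      then show "int n dvd s - t"
      proof cases
        case 2
        then have "int n dvd (s - (t + int n)) + int n"
          by (rule dvd_add) simp
        then show ?thesis by simp
      qed
    qed
    finally show ?thesis
      by (simp add: mod_eq_dvd_iff)
  qed
  have excl: "\<not> (?P s \<and> ?Q s)" for s
  proof
    assume "?P s \<and> ?Q s"
    then have "int (2 * n) dvd (t + int n) - t"
      by (metis mod_eq_dvd_iff)
    then show False
      using assms zdvd_imp_le[of "int (2 * n)" "int n"] by simp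
  qed
  have "8 * N3 t n = card (?S (\<lambda>s. s mod int n = t mod int n))"
    using card_lifted_solutions[OF assms, of t] by simp
  also have "?S (\<lambda>s. s mod int n = t mod int n) = ?S ?P \<union> ?S ?Q"
    unfolding split by blast
  also have "card (?S ?P \<union> ?S ?Q) = card (?S ?P) + card (?S ?Q)"
    using excl by (intro card_Un_disjoint finite_triples) blast
  finally show ?thesis
    by (simp only: N3_eq_card_mod)
qed

section \<open>Targets divisible by four\<close>

lemma square_mod_4: "(x::int)\<^sup>2 mod 4 = (if even x then 0 else 1)"
proof (cases "even x")
  case True
  then obtain y where "x = 2 * y" by (elim evenE)
  then have "x\<^sup>2 = 4 * y\<^sup>2" by (simp add: power2_eq_square)
  then show ?thesis using True by simp
next
  case False
  then obtain y where "x = 2 * y + 1" by (elim oddE)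
  then have "x\<^sup>2 = 1 + 4 * (y\<^sup>2 + y)" by (simp add: power2_eq_square algebra_simps)
  then have "x\<^sup>2 mod 4 = 1" by (simp only: mod_mult_self2) simp
  then show ?thesis using False by simp
qed

lemma four_dvd_sum_three_squares_iff:
  "4 dvd (x::int)\<^sup>2 + y\<^sup>2 + z\<^sup>2 \<longleftrightarrow> even x \<and> even y \<and> even z"
proof -
  have "[x\<^sup>2 + y\<^sup>2 + z\<^sup>2 = x\<^sup>2 mod 4 + y\<^sup>2 mod 4 + z\<^sup>2 mod 4] (mod 4)"
    by (intro cong_add) (simp_all add: cong_def)
  then have "(x\<^sup>2 + y\<^sup>2 + z\<^sup>2) mod 4 = (x\<^sup>2 mod 4 + y\<^sup>2 mod 4 + z\<^sup>2 mod 4) mod 4"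
    by (simp only: cong_def)
  moreover have "4 dvd x\<^sup>2 + y\<^sup>2 + z\<^sup>2 \<longleftrightarrow> (x\<^sup>2 + y\<^sup>2 + z\<^sup>2) mod 4 = 0"
    by (rule dvd_eq_mod_eq_0)
  ultimately show ?thesis
    by (simp only: square_mod_4) simp
qed

lemma N3_four_mult:
  assumes "n > 0"
  shows "N3 (4 * t) (4 * n) = 8 * N3 t n"
proof -
  let ?h = "\<lambda>(x::int, y::int, z::int). (2 * x, 2 * y, 2 * z)"
  let ?A = "{(x, y, z). x \<in> {0..<int (2 * n)} \<and> y \<in> {0..<int (2 * n)} \<and> z \<in> {0..<int (2 * n)} \<and>
              (x\<^sup>2 + y\<^sup>2 + z\<^sup>2) mod int n = t mod int n}"
  let ?B = "{(x, y, z). x \<in> {0..<int (4 * n)} \<and> y \<in> {0..<int (4 * n)} \<and> z \<in> {0..<int (4 * n)} \<and>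
              (x\<^sup>2 + y\<^sup>2 + z\<^sup>2) mod int (4 * n) = (4 * t) mod int (4 * n)}"
  have scale: "((2 * a)\<^sup>2 + (2 * b)\<^sup>2 + (2 * c)\<^sup>2) mod int (4 * n) = (4 * t) mod int (4 * n) \<longleftrightarrow>
               (a\<^sup>2 + b\<^sup>2 + c\<^sup>2) mod int n = t mod int n" for a b c :: int
  proof -
    have "(2 * a)\<^sup>2 + (2 * b)\<^sup>2 + (2 * c)\<^sup>2 = 4 * (a\<^sup>2 + b\<^sup>2 + c\<^sup>2)"
      by (simp add: power2_eq_square)
    then show ?thesis
      by (simp only: of_nat_mult of_nat_numeral mult_mod_right[symmetric]) simp
  qed
  have range: "2 * a \<in> {0..<int (4 * n)} \<longleftrightarrow> a \<in> {0..<int (2 * n)}" for a :: int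
    by auto
  have mem: "?h v \<in> ?B \<longleftrightarrow> v \<in> ?A" for v
    by (cases v) (simp only: mem_Collect_eq prod.case scale range)
  \<comment> \<open>Divisibility by \<open>4\<close> forces every solution into the image of the doubling map.\<close>
  have halves: "v \<in> range ?h" if "v \<in> ?B" for v
  proof -
    obtain x y z where v: "v = (x, y, z)" by (cases v)
    have "(x\<^sup>2 + y\<^sup>2 + z\<^sup>2) mod int (4 * n) = (4 * t) mod int (4 * n)"
      using that unfolding v by blast
    then have "int (4 * n) dvd (x\<^sup>2 + y\<^sup>2 + z\<^sup>2) - 4 * t"
      by (simp only: mod_eq_dvd_iff)
    then have "4 dvd (x\<^sup>2 + y\<^sup>2 + z\<^sup>2) - 4 * t"
      by (rule dvd_trans[rotated]) simp
    then have "4 dvd (x\<^sup>2 + y\<^sup>2 + z\<^sup>2 - 4 * t) + 4 * t"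
      by (rule dvd_add) simp
    then have "4 dvd x\<^sup>2 + y\<^sup>2 + z\<^sup>2"
      by (simp only: diff_add_cancel)
    then have "even x" "even y" "even z"
      by (simp_all only: four_dvd_sum_three_squares_iff)
    then obtain a b c where "x = 2 * a" "y = 2 * b" "z = 2 * c"
      by (elim evenE) blast
    then have "v = ?h (a, b, c)"
      using v by simp
    then show ?thesis
      by (rule range_eqI)
  qed
  have image: "?B = ?h ` ?A"
  proof (intro equalityI subsetI)
    fix v assume v: "v \<in> ?B"
    then obtain w where w: "v = ?h w"
      by (rule rangeE[OF halves])
    then have "w \<in> ?A"
      using v mem by (simp only:)
    with w show "v \<in> ?h ` ?A"
      by (rule image_eqI)
  next
    fix v assume "v \<in> ?h ` ?A"
    then show "v \<in> ?B"
      by (rule imageE) (simp only: mem)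
  qed
  have inj: "inj_on ?h ?A"
    by (rule inj_onI) (simp split: prod.splits)
  have "N3 (4 * t) (4 * n) = card ?B"
    by (rule N3_eq_card_mod)
  also have "\<dots> = card ?A"
    unfolding image by (rule card_image[OF inj])
  also have "\<dots> = 8 * N3 t n"
    by (rule card_lifted_solutions[OF assms])
  finally show ?thesis .
qed

lemma N3_four_power_mult:
  assumes "n > 0"
  shows "N3 (4 ^ j * t) (4 ^ j * n) = 8 ^ j * N3 t n"
proof (induction j)
  case (Suc j)
  have "N3 (4 ^ Suc j * t) (4 ^ Suc j * n) = 8 * N3 (4 ^ j * t) (4 ^ j * n)"
    using N3_four_mult[of "4 ^ j * n" "4 ^ j * t"] assms by (simp add: mult.assoc)
  then show ?case using Suc by simp
qed simp

section \<open>Targets not divisible by four\<close>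

text \<open>For \<open>x = 2 * y + 1\<close> the difference \<open>(x + 4 * q)\<^sup>2 - x\<^sup>2\<close> is \<open>8 * q + 16 * q * (y + q)\<close>. The
  shift is half of the modulus \<open>n = 8 * q\<close> that is being doubled, and \<open>(n div 2)\<^sup>2\<close> vanishes modulo
  \<open>2 * n\<close> because \<open>8\<close> divides \<open>n\<close>; this is why the doubling starts only at modulus \<open>8\<close>.\<close>

lemma odd_square_shift:
  fixes x q :: int
  assumes "odd x"
  shows "[((x + 4 * q) mod (16 * q))\<^sup>2 = x\<^sup>2 + 8 * q] (mod (16 * q))"
proof -
  obtain y where y: "x = 2 * y + 1" using assms by (elim oddE)
  have "(x + 4 * q)\<^sup>2 - (x\<^sup>2 + 8 * q) = (16 * q) * (y + q)"
    unfolding y by (simp add: power2_eq_square algebra_simps)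
  then have "[(x + 4 * q)\<^sup>2 = x\<^sup>2 + 8 * q] (mod (16 * q))"
    by (metis cong_iff_dvd_diff dvd_triv_left)
  then show ?thesis
    unfolding cong_def by (simp only: power_mod)
qed

text \<open>Applied also with \<open>t + 8 * q\<close> in place of \<open>t\<close>, this inequality becomes an equality, so only
  an injection is wanted here. The shift moves the first odd entry; it preserves all parities, so
  the entry that was moved can be read off from the image.\<close>

lemma N3_shift_le:
  assumes "q > 0" and "\<not> 4 dvd t"
  shows "N3 t (16 * q) \<le> N3 (t + 8 * int q) (16 * q)"
proof -
  let ?m = "16 * int q"
  define sh where "sh x = (x + 4 * int q) mod ?m" for x
  define f where "f = (\<lambda>(x, y, z). if odd x then (sh x, y, z)
                     else if odd y then (x, sh y, z) else (x, y, sh z))"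
  let ?S = "\<lambda>u. {(x, y, z). x \<in> {0..<?m} \<and> y \<in> {0..<?m} \<and> z \<in> {0..<?m} \<and>
                  [x\<^sup>2 + y\<^sup>2 + z\<^sup>2 = u] (mod ?m)}"
  have N3_S: "N3 u (16 * q) = card (?S u)" for u
    by (simp add: N3_eq_card_mod cong_def)
  have even_sh: "even (sh x) \<longleftrightarrow> even x" for x
    unfolding sh_def by (subst dvd_mod_iff) simp_all
  have sh_range: "sh x \<in> {0..<?m}" for x
    using assms(1) unfolding sh_def by simp
  have sh_sq: "[(sh x)\<^sup>2 = x\<^sup>2 + 8 * int q] (mod ?m)" if "odd x" for x
    unfolding sh_def by (rule odd_square_shift[OF that])
  have sh_inj: "x = y" if "sh x = sh y" "x \<in> {0..<?m}" "y \<in> {0..<?m}" for x y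
  proof -
    have "[x + 4 * int q = y + 4 * int q] (mod ?m)"
      using that(1) unfolding sh_def cong_def .
    then have "[x = y] (mod ?m)"
      by (simp add: cong_add_rcancel)
    then show ?thesis
      using that(2,3) by (simp add: cong_def)
  qed
  have "f ` ?S t \<subseteq> ?S (t + 8 * int q)"
  proof
    fix v assume "v \<in> f ` ?S t"
    then obtain x y z where v: "v = f (x, y, z)" and xyz: "(x, y, z) \<in> ?S t"
      by auto
    have range: "x \<in> {0..<?m}" "y \<in> {0..<?m}" "z \<in> {0..<?m}"
      and sq: "[x\<^sup>2 + y\<^sup>2 + z\<^sup>2 = t] (mod ?m)"
      using xyz by auto
    have "\<not> 4 dvd x\<^sup>2 + y\<^sup>2 + z\<^sup>2"
    proof -
      have "[x\<^sup>2 + y\<^sup>2 + z\<^sup>2 = t] (mod 4)"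
        using sq by (rule cong_dvd_modulus) simp
      then show ?thesis
        using assms(2) by (simp add: cong_dvd_iff)
    qed
    then have some_odd: "odd x \<or> odd y \<or> odd z"
      by (simp add: four_dvd_sum_three_squares_iff)
    have sq8: "[x\<^sup>2 + y\<^sup>2 + z\<^sup>2 + 8 * int q = t + 8 * int q] (mod ?m)"
      using sq by (rule cong_add) simp
    \<comment> \<open>\<open>a\<close> is the square of the shifted entry, \<open>b\<close> the old square, and \<open>c\<close> the sum of the other two
      squares.\<close>
    have move: "[a + c = t + 8 * int q] (mod ?m)"
      if "[a = b + 8 * int q] (mod ?m)" and "b + c = x\<^sup>2 + y\<^sup>2 + z\<^sup>2" for a b c
    proof -
      have "[a + c = b + 8 * int q + c] (mod ?m)"
        using that(1) by (rule cong_add) simp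
      moreover have "b + 8 * int q + c = x\<^sup>2 + y\<^sup>2 + z\<^sup>2 + 8 * int q"
        using that(2) by simp
      ultimately show ?thesis
        using sq8 by (simp only: cong_def)
    qed
    consider "odd x" | "even x" "odd y" | "even x" "even y" "odd z"
      using some_odd by blast
    then show "v \<in> ?S (t + 8 * int q)"
    proof cases
      case 1
      then have "f (x, y, z) = (sh x, y, z)"
        unfolding f_def by simp
      moreover have "[(sh x)\<^sup>2 + (y\<^sup>2 + z\<^sup>2) = t + 8 * int q] (mod ?m)"
        by (rule move[OF sh_sq[OF 1]]) simp
      ultimately show ?thesis
        using range sh_range[of x] unfolding v by (simp only: mem_Collect_eq prod.case add_ac simp_thms)
    next
      case 2
      then have "f (x, y, z) = (x, sh y, z)"
        unfolding f_def by simp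
      moreover have "[(sh y)\<^sup>2 + (x\<^sup>2 + z\<^sup>2) = t + 8 * int q] (mod ?m)"
        by (rule move[OF sh_sq[OF 2(2)]]) simp
      ultimately show ?thesis
        using range sh_range[of y] unfolding v by (simp only: mem_Collect_eq prod.case add_ac simp_thms)
    next
      case 3
      then have "f (x, y, z) = (x, y, sh z)"
        unfolding f_def by simp
      moreover have "[(sh z)\<^sup>2 + (x\<^sup>2 + y\<^sup>2) = t + 8 * int q] (mod ?m)"
        by (rule move[OF sh_sq[OF 3(3)]]) simp
      ultimately show ?thesis
        using range sh_range[of z] unfolding v by (simp only: mem_Collect_eq prod.case add_ac simp_thms)
    qed
  qed
  moreover have "inj_on f (?S t)"
  proof (rule inj_onI)
    fix v w assume vw: "v \<in> ?S t" "w \<in> ?S t" "f v = f w"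
    obtain x y z x' y' z' where v: "v = (x, y, z)" and w: "w = (x', y', z')"
      by (cases v, cases w)
    have range: "x \<in> {0..<?m}" "y \<in> {0..<?m}" "z \<in> {0..<?m}"
      "x' \<in> {0..<?m}" "y' \<in> {0..<?m}" "z' \<in> {0..<?m}"
      using vw(1,2) unfolding v w by blast+
    have f_eq: "f (x, y, z) = f (x', y', z')"
      using vw(3) unfolding v w .
    have par1: "even (fst (f (a, b, c))) \<longleftrightarrow> even a" for a b c
      unfolding f_def by (simp add: even_sh)
    have par2: "even (fst (snd (f (a, b, c)))) \<longleftrightarrow> even b" for a b c
      unfolding f_def by (simp add: even_sh)
    have even_x: "even x' \<longleftrightarrow> even x"
      by (simp only: par1[of x y z, symmetric] par1[of x' y' z', symmetric] f_eq)
    have even_y: "even y' \<longleftrightarrow> even y"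
      by (simp only: par2[of x y z, symmetric] par2[of x' y' z', symmetric] f_eq)
    consider "odd x" | "even x" "odd y" | "even x" "even y"
      by blast
    then show "v = w"
    proof cases
      case 1
      then have "sh x = sh x'" "y = y'" "z = z'"
        using f_eq even_x unfolding f_def by simp_all
      then show ?thesis
        using sh_inj range unfolding v w by blast
    next
      case 2
      then have "x = x'" "sh y = sh y'" "z = z'"
        using f_eq even_x even_y unfolding f_def by simp_all
      then show ?thesis
        using sh_inj range unfolding v w by blast
    next
      case 3
      then have "x = x'" "y = y'" "sh z = sh z'"
        using f_eq even_x even_y unfolding f_def by simp_all
      then show ?thesis
        using sh_inj range unfolding v w by blast
    qed
  qed
  ultimately show ?thesis
    unfolding N3_S by (intro card_inj_on_le[of f] finite_triples)
qed

lemma N3_double: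
  assumes "q > 0" and "\<not> 4 dvd t"
  shows "N3 t (16 * q) = 4 * N3 t (8 * q)"
proof -
  have "4 dvd 8 * int q"
    by simp
  then have "\<not> 4 dvd t + 8 * int q"
    using assms(2) by (simp add: dvd_add_left_iff)
  then have "N3 (t + 8 * int q) (16 * q) \<le> N3 (t + 8 * int q + 8 * int q) (16 * q)"
    by (rule N3_shift_le[OF assms(1)])
  also have "\<dots> = N3 t (16 * q)"
    by (rule N3_cong) (simp add: cong_def)
  finally have "N3 (t + 8 * int q) (16 * q) = N3 t (16 * q)"
    using N3_shift_le[OF assms] by simp
  then show ?thesis
    using N3_lift_sum[of "8 * q" t] assms(1) by simp
qed

lemma N3_power_two:
  assumes "\<not> 4 dvd t"
  shows "N3 t (2 ^ (i + 3)) = 4 ^ i * N3 t 8"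
proof (induction i)
  case (Suc i)
  have "N3 t (16 * 2 ^ i) = 4 * N3 t (8 * 2 ^ i)"
    by (rule N3_double) (simp_all add: assms)
  then show ?case
    using Suc by (simp add: power_add mult.commute)
qed simp

section \<open>The moduli up to eight\<close>

text \<open>An executable form of the count, on which the simplifier can enumerate the triples for a
  numeral modulus.\<close>

lemma N3_eq_length_filter:
  "N3 t n = length (filter (\<lambda>(x, y, z). (x * x + y * y + z * z) mod int n = t mod int n)
     (List.product [0..int n - 1] (List.product [0..int n - 1] [0..int n - 1])))"
    (is "_ = length (filter ?P ?xs)")
proof -
  have "distinct (filter ?P ?xs)"
    by (intro distinct_filter distinct_product distinct_upto)
  then have "length (filter ?P ?xs) = card (set (filter ?P ?xs))"
    by (rule distinct_card[symmetric])
  also have "\<dots> = N3 t n"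
    unfolding N3_eq_card_mod by (rule arg_cong[where f = card]) (auto simp: power2_eq_square)
  finally show ?thesis ..
qed

lemma N3_mod_1: "N3 0 1 = 1"
  unfolding N3_eq_length_filter by code_simp

lemma N3_mod_2: "N3 0 2 = 4" "N3 1 2 = 4"
  unfolding N3_eq_length_filter by code_simp+

lemma N3_mod_4: "N3 1 4 = 24" "N3 2 4 = 24" "N3 3 4 = 8"
  unfolding N3_eq_length_filter by code_simp+

lemma N3_mod_8: "N3 1 8 = 96" "N3 2 8 = 96" "N3 3 8 = 64" "N3 5 8 = 96" "N3 6 8 = 96" "N3 7 8 = 0"
  unfolding N3_eq_length_filter by code_simp+

lemma N3_residue_8: "[s = r] (mod 8) \<Longrightarrow> N3 s 8 = N3 r 8"
  by (rule N3_cong) simp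

lemma N3_residue_4: "[s = r] (mod 4) \<Longrightarrow> N3 s 4 = N3 r 4"
  by (rule N3_cong) simp

text \<open>Modulo \<open>8\<close> the counts for \<open>1\<close> and \<open>5\<close> agree, as do those for \<open>2\<close> and \<open>6\<close>. So a
  target that is \<open>1\<close> modulo \<open>4\<close>, and likewise one that is twice odd, has a single count.\<close>

lemma N3_8_one_mod_4:
  assumes "[b = 1] (mod 4)"
  shows "N3 b 8 = 96"
proof -
  have "b mod 8 = 1 \<or> b mod 8 = 5"
    using assms unfolding cong_def by presburger
  then have "[b = 1] (mod 8) \<or> [b = 5] (mod 8)"
    by (simp add: cong_def)
  then show ?thesis
    using N3_residue_8 N3_mod_8 by metis
qed

lemma N3_8_twice_odd:
  assumes "odd b"
  shows "N3 (2 * b) 8 = 96"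
proof -
  have "(2 * b) mod 8 = 2 \<or> (2 * b) mod 8 = 6"
    using assms by presburger
  then have "[2 * b = 2] (mod 8) \<or> [2 * b = 6] (mod 8)"
    by (simp add: cong_def)
  then show ?thesis
    using N3_residue_8 N3_mod_8 by metis
qed

lemma N3_4_twice_odd:
  assumes "odd b"
  shows "N3 (2 * b) 4 = 24"
proof -
  have "(2 * b) mod 4 = 2"
    using assms by presburger
  then have "[2 * b = 2] (mod 4)"
    by (simp add: cong_def)
  then show ?thesis
    using N3_residue_4 N3_mod_4 by metis
qed

lemma N3_2_odd:
  assumes "odd b"
  shows "N3 b 2 = 4"
proof -
  have "b mod 2 = 1"
    using assms by presburger
  then have "N3 b 2 = N3 1 2"
    by (intro N3_cong) (simp add: cong_def)
  then show ?thesis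
    by (simp add: N3_mod_2)
qed

section \<open>Combining the reductions\<close>

lemma N3_strip_fours: "N3 (4 ^ j * s) (2 ^ (2 * j + i)) = 8 ^ j * N3 s (2 ^ i)"
proof -
  have "(2::nat) ^ (2 * j + i) = 4 ^ j * 2 ^ i"
    by (simp add: power_add power_mult)
  then show ?thesis
    using N3_four_power_mult[of "2 ^ i" j s] by simp
qed

text \<open>Each of the \<open>j\<close> factors of \<open>4\<close> stripped from target and modulus contributes a factor \<open>8\<close> to
  the count, and each of the \<open>i\<close> halvings of the modulus down to \<open>8\<close> contributes a factor \<open>4\<close>.\<close>

lemma N3_strip_fours_large:
  assumes "\<not> 4 dvd s"
  shows "N3 (4 ^ j * s) (2 ^ (2 * j + (i + 3))) = 2 ^ (3 * j + 2 * i) * N3 s 8"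
proof -
  have "(8::nat) ^ j * 4 ^ i = 2 ^ (3 * j + 2 * i)"
    by (simp add: power_add power_mult)
  then show ?thesis
    by (simp only: N3_strip_fours N3_power_two[OF assms] mult.assoc[symmetric])
qed

lemma N3_zero:
  "N3 0 (2 ^ (2 * j)) = 2 ^ (3 * j)" "N3 0 (2 ^ (2 * j + 1)) = 2 ^ (3 * j + 2)"
proof -
  have eight: "(8::nat) ^ j = 2 ^ (3 * j)"
    by (simp add: power_mult)
  show "N3 0 (2 ^ (2 * j)) = 2 ^ (3 * j)"
    using N3_strip_fours[of j 0 0] N3_mod_1 by (simp add: eight)
  show "N3 0 (2 ^ (2 * j + 1)) = 2 ^ (3 * j + 2)"
    using N3_strip_fours[of j 0 1] N3_mod_2 by (simp add: eight power_add)
qed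

theorem theorem1p4:
  fixes k :: nat and t :: int
  assumes "k \<ge> 3"
    and "t \<in> carrier (residue_ring (2 ^ k))"
  shows
    "(t = 0 \<longrightarrow>
        (even k \<longrightarrow> N3 t (2 ^ k) = 2 ^ (3 * k div 2)) \<and>
        (odd k \<longrightarrow> N3 t (2 ^ k) = 2 ^ ((3 * k + 1) div 2))) \<and>
     (t \<noteq> 0 \<longrightarrow>
       (\<forall>(\<alpha>::nat) (\<beta>::int). t = 2 ^ \<alpha> * \<beta> \<and> \<not> 2 dvd \<beta> \<and> \<alpha> < k \<longrightarrow>
        (k - \<alpha> > 2 \<and> even \<alpha> \<and> [\<beta> = 1] (mod 4) \<longrightarrow>
           N3 t (2 ^ k) = 3 * 2 ^ (2 * k - \<alpha> div 2 - 1)) \<and>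
        (k - \<alpha> > 2 \<and> even \<alpha> \<and> [\<beta> = 3] (mod 8) \<longrightarrow>
           N3 t (2 ^ k) = 2 ^ (2 * k - \<alpha> div 2)) \<and>
        (k - \<alpha> > 2 \<and> even \<alpha> \<and> [\<beta> = 7] (mod 8) \<longrightarrow>
           N3 t (2 ^ k) = 0) \<and>
        (k - \<alpha> > 2 \<and> odd \<alpha> \<longrightarrow>
           N3 t (2 ^ k) = 3 * 2 ^ (2 * k - (\<alpha> + 1) div 2)) \<and>
        (k - \<alpha> = 2 \<and> even \<alpha> \<and> [\<beta> = 1] (mod 4) \<longrightarrow>
           N3 t (2 ^ k) = 3 * 2 ^ (3 * k div 2)) \<and>
        (k - \<alpha> = 2 \<and> even \<alpha> \<and> [\<beta> = 3] (mod 4) \<longrightarrow>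
           N3 t (2 ^ k) = 2 ^ (3 * k div 2)) \<and>
        (k - \<alpha> = 2 \<and> odd \<alpha> \<longrightarrow>
           N3 t (2 ^ k) = 3 * 2 ^ ((3 * k + 1) div 2)) \<and>
        (k - \<alpha> = 1 \<and> even \<alpha> \<longrightarrow>
           N3 t (2 ^ k) = 2 ^ ((3 * k + 1) div 2)) \<and>
        (k - \<alpha> = 1 \<and> odd \<alpha> \<longrightarrow>
           N3 t (2 ^ k) = 3 * 2 ^ (3 * k div 2))))"
proof (intro conjI impI allI)
  assume "t = 0" "even k"
  then obtain j where "k = 2 * j" by (elim evenE)
  then show "N3 t (2 ^ k) = 2 ^ (3 * k div 2)"
    using N3_zero(1)[of j] \<open>t = 0\<close> by simp
next
  assume "t = 0" "odd k"
  then obtain j where j: "k = 2 * j + 1" by (elim oddE)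
  have "(3 * k + 1) div 2 = 3 * j + 2"
    unfolding j by simp
  then show "N3 t (2 ^ k) = 2 ^ ((3 * k + 1) div 2)"
    using N3_zero(2)[of j] \<open>t = 0\<close> j by simp
next
  fix \<alpha> :: nat and \<beta> :: int
  assume "t = 2 ^ \<alpha> * \<beta> \<and> \<not> 2 dvd \<beta> \<and> \<alpha> < k"
  then have t: "t = 2 ^ \<alpha> * \<beta>" and "odd \<beta>" and "\<alpha> < k"
    by blast+
  have not4: "\<not> 4 dvd \<beta>" "\<not> 4 dvd 2 * \<beta>"
    using \<open>odd \<beta>\<close> by presburger+
  have t_even: "t = 4 ^ j * \<beta>" if "\<alpha> = 2 * j" for j
    using t that by (simp add: power_mult)
  have t_odd: "t = 4 ^ j * (2 * \<beta>)" if "\<alpha> = 2 * j + 1" for j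
    using t that by (simp add: power_mult)
  have large_even: "\<exists>j i. \<alpha> = 2 * j \<and> k = 2 * j + (i + 3) \<and>
      N3 t (2 ^ k) = 2 ^ (3 * j + 2 * i) * N3 \<beta> 8" if "k - \<alpha> > 2" "even \<alpha>"
  proof -
    obtain j where j: "\<alpha> = 2 * j" using \<open>even \<alpha>\<close> by (elim evenE)
    have k: "k = 2 * j + (k - \<alpha> - 3 + 3)" using that(1) j by simp
    show ?thesis
      using j k t_even[OF j] N3_strip_fours_large[OF not4(1), of j "k - \<alpha> - 3"] by metis
  qed
  have small_even: "\<exists>j. k = 2 * j + i \<and> N3 t (2 ^ k) = 2 ^ (3 * j) * N3 \<beta> (2 ^ i)"
    if "k - \<alpha> = i" "even \<alpha>" for i
  proof -
    obtain j where j: "\<alpha> = 2 * j" using \<open>even \<alpha>\<close> by (elim evenE)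
    have k: "k = 2 * j + i" using that(1) j \<open>\<alpha> < k\<close> by simp
    have "(8::nat) ^ j = 2 ^ (3 * j)" by (simp add: power_mult)
    then show ?thesis
      using k t_even[OF j] N3_strip_fours[of j \<beta> i] by metis
  qed

  show "N3 t (2 ^ k) = 3 * 2 ^ (2 * k - \<alpha> div 2 - 1)"
    if H: "k - \<alpha> > 2 \<and> even \<alpha> \<and> [\<beta> = 1] (mod 4)"
  proof -
    obtain j i where ji: "\<alpha> = 2 * j" "k = 2 * j + (i + 3)"
      and N: "N3 t (2 ^ k) = 2 ^ (3 * j + 2 * i) * N3 \<beta> 8"
      using large_even H by blast
    have "2 * k - \<alpha> div 2 - 1 = (3 * j + 2 * i) + 5"
      using ji by simp
    then show ?thesis
      using N N3_8_one_mod_4 H by (simp add: power_add)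
  qed
  show "N3 t (2 ^ k) = 2 ^ (2 * k - \<alpha> div 2)"
    if H: "k - \<alpha> > 2 \<and> even \<alpha> \<and> [\<beta> = 3] (mod 8)"
  proof -
    obtain j i where ji: "\<alpha> = 2 * j" "k = 2 * j + (i + 3)"
      and N: "N3 t (2 ^ k) = 2 ^ (3 * j + 2 * i) * N3 \<beta> 8"
      using large_even H by blast
    have "2 * k - \<alpha> div 2 = (3 * j + 2 * i) + 6"
      using ji by simp
    then show ?thesis
      using N N3_residue_8[of \<beta> 3] N3_mod_8 H by (simp add: power_add)
  qed
  show "N3 t (2 ^ k) = 0" if H: "k - \<alpha> > 2 \<and> even \<alpha> \<and> [\<beta> = 7] (mod 8)"
    using large_even N3_residue_8[of \<beta> 7] N3_mod_8 H by auto
  show "N3 t (2 ^ k) = 3 * 2 ^ (2 * k - (\<alpha> + 1) div 2)" if H: "k - \<alpha> > 2 \<and> odd \<alpha>"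
  proof -
    obtain j where j: "\<alpha> = 2 * j + 1" using H by (elim conjE oddE)
    define i where "i = k - \<alpha> - 3"
    have i: "k = 2 * j + (i + 1 + 3)"
      using H j unfolding i_def by simp
    have "N3 t (2 ^ k) = 2 ^ (3 * j + 2 * (i + 1)) * 96"
      using N3_strip_fours_large[OF not4(2), of j "i + 1"] N3_8_twice_odd[OF \<open>odd \<beta>\<close>] t_odd[OF j] i
      by simp
    moreover have "2 * k - (\<alpha> + 1) div 2 = (3 * j + 2 * (i + 1)) + 5"
      using i j by simp
    ultimately show ?thesis
      by (simp add: power_add)
  qed
  show "N3 t (2 ^ k) = 3 * 2 ^ (3 * k div 2)"
    if H: "k - \<alpha> = 2 \<and> even \<alpha> \<and> [\<beta> = 1] (mod 4)"
  proof -
    obtain j where j: "k = 2 * j + 2" and N: "N3 t (2 ^ k) = 2 ^ (3 * j) * N3 \<beta> (2 ^ 2)"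
      using small_even H by blast
    have "3 * k div 2 = 3 * j + 3"
      using j by simp
    then show ?thesis
      using N N3_residue_4[of \<beta> 1] N3_mod_4 H by (simp add: power_add)
  qed
  show "N3 t (2 ^ k) = 2 ^ (3 * k div 2)"
    if H: "k - \<alpha> = 2 \<and> even \<alpha> \<and> [\<beta> = 3] (mod 4)"
  proof -
    obtain j where j: "k = 2 * j + 2" and N: "N3 t (2 ^ k) = 2 ^ (3 * j) * N3 \<beta> (2 ^ 2)"
      using small_even H by blast
    have "3 * k div 2 = 3 * j + 3"
      using j by simp
    then show ?thesis
      using N N3_residue_4[of \<beta> 3] N3_mod_4 H by (simp add: power_add)
  qed
  show "N3 t (2 ^ k) = 3 * 2 ^ ((3 * k + 1) div 2)" if H: "k - \<alpha> = 2 \<and> odd \<alpha>"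
  proof -
    obtain j where j: "\<alpha> = 2 * j + 1" using H by (elim conjE oddE)
    have k: "k = 2 * j + (0 + 3)"
      using H j by simp
    have "N3 t (2 ^ k) = 2 ^ (3 * j) * 96"
      using N3_strip_fours_large[OF not4(2), of j 0] N3_8_twice_odd[OF \<open>odd \<beta>\<close>] t_odd[OF j] k
      by simp
    moreover have "(3 * k + 1) div 2 = 3 * j + 5"
      using k by simp
    ultimately show ?thesis
      by (simp add: power_add)
  qed
  show "N3 t (2 ^ k) = 2 ^ ((3 * k + 1) div 2)" if H: "k - \<alpha> = 1 \<and> even \<alpha>"
  proof -
    obtain j where j: "k = 2 * j + 1" and N: "N3 t (2 ^ k) = 2 ^ (3 * j) * N3 \<beta> (2 ^ 1)"
      using small_even H by blast
    have "(3 * k + 1) div 2 = 3 * j + 2"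
      using j by simp
    then show ?thesis
      using N N3_2_odd[OF \<open>odd \<beta>\<close>] by (simp add: power_add)
  qed
  show "N3 t (2 ^ k) = 3 * 2 ^ (3 * k div 2)" if H: "k - \<alpha> = 1 \<and> odd \<alpha>"
  proof -
    obtain j where j: "\<alpha> = 2 * j + 1" using H by (elim conjE oddE)
    have k: "k = 2 * j + 2"
      using H j by simp
    have "N3 t (2 ^ k) = 8 ^ j * 24"
      using N3_strip_fours[of j "2 * \<beta>" 2] N3_4_twice_odd[OF \<open>odd \<beta>\<close>] t_odd[OF j] k
      by simp
    moreover have "3 * k div 2 = 3 * j + 3"
      using k by simp
    ultimately show ?thesis
      by (simp add: power_add power_mult)
  qed
qed

end
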